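(* Let $1 \leq p < \infty$, let $f \in L^p(\mathbb{R})$, let $k \geq 0$ be an integer, and let $x_0\in\mathbb{R}$. If $f$ is $C^{k+1}$ in a neighborhood of $x_0$, then its Hilbert transform $Hf$ is $C^{k}$ in a neighborhood of $x_0$. In particular, if $f$ is $C^{\infty}$ at $x_0$, then $Hf$ is also $C^{\infty}$ at $x_0$.
   Context: For $f \in L^p(\mathbb{R})$, $1 \leq p<\infty$, the Hilbert transform of $f$ is defined (for a.e. $x$) as the principal value $$Hf(x) = p.v.\,\frac{1}{\pi}\int_{-\infty}^{\infty}\frac{f(t)}{x-t}\,dt := \lim_{\epsilon\to 0}\frac{1}{\pi}\int_{|x-t|>\epsilon}\frac{f(t)}{x-t}\,dt.$$ A function is said to be $C^\infty$ at a point if it is $C^\infty$ in a neighborhood of that point. *)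

theory Defs
  imports "HOL-Analysis.Analysis"
begin

text \<open>Membership in \<open>L\<^sup>p(\<real>)\<close> for complex-valued functions; intended for \<open>1 \<le> p < \<infinity>\<close>.\<close>

definition Lp_real :: "real \<Rightarrow> (real \<Rightarrow> complex) set" where
  "Lp_real p = {f. f \<in> borel_measurable lebesgue \<and> integrable lebesgue (\<lambda>t. norm (f t) powr p)}"

definition truncated_hilbert :: "(real \<Rightarrow> complex) \<Rightarrow> real \<Rightarrow> real \<Rightarrow> complex" where
  "truncated_hilbert f x \<epsilon> =
     complex_of_real (1 / pi) *
       (LINT t:{t. \<bar>x - t\<bar> > \<epsilon>}|lebesgue. f t / complex_of_real (x - t))"

text \<open>\<open>Lim\<close> is unspecified when the limit does not exist, and a Bochner integral is \<open>0\<close> when the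
  integrand is not integrable. So \<open>hilbert_transform f x\<close> is meaningful only at points \<open>x\<close>
  satisfying \<open>hilbert_pv_exists f x\<close>.\<close>

definition hilbert_transform :: "(real \<Rightarrow> complex) \<Rightarrow> real \<Rightarrow> complex" where
  "hilbert_transform f x = Lim (at_right 0) (truncated_hilbert f x)"

definition hilbert_pv_exists :: "(real \<Rightarrow> complex) \<Rightarrow> real \<Rightarrow> bool" where
  "hilbert_pv_exists f x \<longleftrightarrow>
     (\<forall>\<epsilon>>0. set_integrable lebesgue {t. \<bar>x - t\<bar> > \<epsilon>} (\<lambda>t. f t / complex_of_real (x - t))) \<and>
     (\<exists>L. (truncated_hilbert f x \<longlongrightarrow> L) (at_right 0))"

text \<open>\<open>C\<^sup>k\<close> on an open set of reals; the derivative is taken in the full neighbourhood filter,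
  so these are intended for open \<open>U\<close> only.\<close>

primrec Ck_on :: "nat \<Rightarrow> (real \<Rightarrow> complex) \<Rightarrow> real set \<Rightarrow> bool" where
  "Ck_on 0 g U \<longleftrightarrow> continuous_on U g"
| "Ck_on (Suc k) g U \<longleftrightarrow>
     (\<forall>x\<in>U. g differentiable (at x)) \<and> Ck_on k (\<lambda>x. vector_derivative g (at x)) U"

definition Cinf_on :: "(real \<Rightarrow> complex) \<Rightarrow> real set \<Rightarrow> bool" where
  "Cinf_on g U \<longleftrightarrow> (\<forall>k. Ck_on k g U)"

end

theory Submission
  imports Defs
begin

text \<open>Fix a window \<open>[a, b]\<close> around \<open>x0\<close> on which \<open>f\<close> is \<open>C\<^sup>k\<^sup>+\<^sup>1\<close>, and let \<open>x\<close> stay well inside it.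
  The part of the integral outside the window may be differentiated under the integral sign any
  number of times. Inside the window write \<open>f t = f x + (t - x) * g x t\<close>, where
  \<open>g x t\<close> is the integral of \<open>f' (x + s * (t - x))\<close> over \<open>s \<in> [0, 1]\<close>. The term \<open>f x\<close> contributes
  \<open>f x * ln ((x - a) / (b - x))\<close> to the principal value, since the singularities at \<open>x\<close> cancel,
  and \<open>g\<close> contributes an ordinary integral over a rectangle, which is \<open>C\<^sup>k\<close> in \<open>x\<close>
  because \<open>f'\<close> is.\<close>

section \<open>Closure properties of \<open>Ck_on\<close>\<close>

text \<open>On an open set, agreement on \<open>U\<close> is agreement near each point of
  \<open>U\<close>, so the derivatives agree on \<open>U\<close> as well and the induction passes to
  them.\<close>

lemma Ck_on_cong:
  assumes "open U" "\<And>x. x \<in> U \<Longrightarrow> f x = g x" "Ck_on k f U"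
  shows "Ck_on k g U"
  using assms(2,3)
proof (induction k arbitrary: f g)
  case 0
  then show ?case
    using continuous_on_cong[of U U f g] by simp
next
  case (Suc k)
  have d: "(g has_vector_derivative vector_derivative f (at x)) (at x)" if "x \<in> U" for x
  proof (rule has_vector_derivative_transform_within_open[OF _ assms(1) that])
    show "(f has_vector_derivative vector_derivative f (at x)) (at x)"
      using Suc.prems that by (simp add: vector_derivative_works)
  qed (use Suc.prems in auto)
  have "Ck_on k (\<lambda>x. vector_derivative g (at x)) U"
  proof (rule Suc.IH)
    show "vector_derivative f (at x) = vector_derivative g (at x)" if "x \<in> U" for x
      using d[OF that] by (simp add: vector_derivative_at)
    show "Ck_on k (\<lambda>x. vector_derivative f (at x)) U"
      using Suc.prems by simp
  qed
  then show ?case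
    using d differentiableI_vector by auto
qed

text \<open>Lets later proofs work with an explicit formula for the derivative in place of the term
  \<open>vector_derivative g (at x)\<close>.\<close>

lemma Ck_on_SucI:
  assumes "open U" "\<And>x. x \<in> U \<Longrightarrow> (g has_vector_derivative g' x) (at x)" "Ck_on k g' U"
  shows "Ck_on (Suc k) g U"
proof -
  have "Ck_on k (\<lambda>x. vector_derivative g (at x)) U"
    by (rule Ck_on_cong[OF assms(1) _ assms(3)]) (simp add: assms(2) vector_derivative_at[symmetric])
  then show ?thesis
    using assms(2) differentiableI_vector by fastforce
qed

lemma Ck_on_Suc_has_vector_derivative:
  assumes "Ck_on (Suc k) g U" "x \<in> U"
  shows "(g has_vector_derivative vector_derivative g (at x)) (at x)"
  using assms by (simp add: vector_derivative_works)

lemma Ck_on_SucD: "Ck_on (Suc k) g U \<Longrightarrow> Ck_on k g U"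
proof (induction k arbitrary: g)
  case 0
  then show ?case
    by (auto intro!: differentiable_imp_continuous_on simp: differentiable_on_def differentiable_at_withinI)
next
  case (Suc k)
  then show ?case by simp
qed

lemma Ck_on_subset: "Ck_on k g U \<Longrightarrow> V \<subseteq> U \<Longrightarrow> Ck_on k g V"
  by (induction k arbitrary: g) (auto intro: continuous_on_subset)

lemma Ck_on_imp_continuous_on: "Ck_on k g U \<Longrightarrow> continuous_on U g"
proof (induction k)
  case (Suc k)
  then show ?case using Ck_on_SucD by blast
qed simp

lemma Ck_on_add:
  assumes "open U" "Ck_on k f U" "Ck_on k g U"
  shows "Ck_on k (\<lambda>x. f x + g x) U"
  using assms(2,3)
proof (induction k arbitrary: f g)
  case 0
  then show ?case by (auto intro: continuous_on_add)
next
  case (Suc k)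
  show ?case
    by (rule Ck_on_SucI[OF assms(1) _ Suc.IH])
      (use Suc.prems in \<open>auto intro: has_vector_derivative_add Ck_on_Suc_has_vector_derivative[OF Suc.prems(1)]
        Ck_on_Suc_has_vector_derivative[OF Suc.prems(2)]\<close>)
qed

lemma Ck_on_mult:
  assumes "open U" "Ck_on k f U" "Ck_on k g U"
  shows "Ck_on k (\<lambda>x. f x * g x) U"
  using assms(2,3)
proof (induction k arbitrary: f g)
  case 0
  then show ?case by (auto intro: continuous_on_mult)
next
  case (Suc k)
  have "Ck_on k (\<lambda>x. f x * vector_derivative g (at x) + vector_derivative f (at x) * g x) U"
    using Suc.prems Ck_on_SucD[OF Suc.prems(1)] Ck_on_SucD[OF Suc.prems(2)]
    by (intro Ck_on_add Suc.IH assms(1)) auto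
  then show ?case
    by (rule Ck_on_SucI[OF assms(1), rotated])
      (rule has_vector_derivative_mult[OF Ck_on_Suc_has_vector_derivative[OF Suc.prems(1)]
          Ck_on_Suc_has_vector_derivative[OF Suc.prems(2)]])
qed

lemma Ck_on_const: "Ck_on k (\<lambda>_. c) U"
  by (induction k arbitrary: c) auto

section \<open>Differentiation under a Lebesgue integral\<close>

text \<open>For \<open>y\<close> other than \<open>x\<close>, the normalised remainder in the
  Frechet definition has the same norm as the difference quotient minus \<open>f'\<close>. The
  quotient form can be tested along sequences, as dominated convergence requires.\<close>

lemma has_vector_derivative_iff_quotient:
  "(f has_vector_derivative f') (at x within S) \<longleftrightarrow>
   ((\<lambda>y. (f y - f x) /\<^sub>R (y - x)) \<longlongrightarrow> f') (at x within S)"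
proof -
  have "norm ((1 / norm (y - x)) *\<^sub>R (f y - (f x + (y - x) *\<^sub>R f'))) = norm ((f y - f x) /\<^sub>R (y - x) - f')"
    if "y \<noteq> x" for y
  proof -
    have "(f y - f x) /\<^sub>R (y - x) - f' = (1 / (y - x)) *\<^sub>R (f y - (f x + (y - x) *\<^sub>R f'))"
      using that by (simp add: scaleR_diff_right scaleR_add_right divide_inverse)
    then show ?thesis by simp
  qed
  then have "((\<lambda>y. norm ((1 / norm (y - x)) *\<^sub>R (f y - (f x + (y - x) *\<^sub>R f')))) \<longlongrightarrow> 0) (at x within S) \<longleftrightarrow>
      ((\<lambda>y. norm ((f y - f x) /\<^sub>R (y - x) - f')) \<longlongrightarrow> 0) (at x within S)"
    by (intro filterlim_cong refl) (auto simp: eventually_at_filter)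
  then show ?thesis
    unfolding has_vector_derivative_def has_derivative_within
    by (simp add: bounded_linear_scaleR_left tendsto_norm_zero_iff LIM_zero_iff del: norm_scaleR)
qed

text \<open>Dominated convergence applied to difference quotients: they converge pointwise to
  \<open>K' x t\<close>, and the mean value inequality bounds them by the same \<open>w\<close> that
  bounds \<open>K'\<close>.\<close>

lemma has_vector_derivative_lebesgue_integral:
  fixes K K' :: "real \<Rightarrow> 'a \<Rightarrow> 'b::{banach,second_countable_topology}"
  assumes V: "open V" "convex V" "x \<in> V"
    and K: "\<And>y. y \<in> V \<Longrightarrow> integrable M (K y)"
    and K': "K' x \<in> borel_measurable M"
    and d: "\<And>y t. y \<in> V \<Longrightarrow> ((\<lambda>y. K y t) has_vector_derivative K' y t) (at y)"
    and w: "integrable M w" "\<And>y t. y \<in> V \<Longrightarrow> norm (K' y t) \<le> w t"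
  shows "((\<lambda>y. LINT t|M. K y t) has_vector_derivative (LINT t|M. K' x t)) (at x)"
proof -
  have "((\<lambda>y. ((LINT t|M. K y t) - (LINT t|M. K x t)) /\<^sub>R (y - x)) \<longlongrightarrow> (LINT t|M. K' x t)) (at x within V)"
    unfolding tendsto_at_iff_sequentially
  proof (intro allI impI)
    fix X :: "nat \<Rightarrow> real"
    assume X: "\<forall>i. X i \<in> V - {x}" "X \<longlonglongrightarrow> x"
    let ?s = "\<lambda>i t. (K (X i) t - K x t) /\<^sub>R (X i - x)"
    have "(\<lambda>i. LINT t|M. ?s i t) \<longlonglongrightarrow> (LINT t|M. K' x t)"
    proof (rule integral_dominated_convergence[OF K' _ w(1)])
      show "?s i \<in> borel_measurable M" for i
        using K[of x] K[of "X i"] X V by (auto intro!: borel_measurable_scaleR borel_measurable_diff)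
      show "AE t in M. (\<lambda>i. ?s i t) \<longlonglongrightarrow> K' x t"
      proof (rule AE_I2)
        fix t
        have "((\<lambda>y. (K y t - K x t) /\<^sub>R (y - x)) \<longlongrightarrow> K' x t) (at x within V)"
          using has_vector_derivative_at_within[OF d[OF V(3), of t], of V]
          by (simp add: has_vector_derivative_iff_quotient)
        then show "(\<lambda>i. ?s i t) \<longlonglongrightarrow> K' x t"
          using X unfolding tendsto_at_iff_sequentially o_def by blast
      qed
      show "AE t in M. norm (?s i t) \<le> w t" for i
      proof (rule AE_I2)
        fix t
        \<comment> \<open>Convexity of \<open>V\<close> keeps the segment from \<open>x\<close> to
          \<open>X i\<close> inside the region where \<open>w t\<close> bounds the
          derivative.\<close>
        have "norm (K (X i) t - K x t) \<le> w t * norm (X i - x)"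
        proof (rule differentiable_bound[OF V(2)])
          show "((\<lambda>y. K y t) has_derivative (\<lambda>h. h *\<^sub>R K' y t)) (at y within V)" if "y \<in> V" for y
            using d[OF that] has_vector_derivative_at_within has_vector_derivative_def by blast
          show "onorm (\<lambda>h. h *\<^sub>R K' y t) \<le> w t" if "y \<in> V" for y
            using w(2)[OF that, of t] order_trans[OF norm_ge_zero]
            by (intro onorm_bound) (auto simp: mult.commute mult_left_mono)
        qed (use X V in auto)
        moreover have "norm (?s i t) = norm (K (X i) t - K x t) / norm (X i - x)"
          by (simp add: divide_inverse_commute del: scaleR_diff_right)
        ultimately show "norm (?s i t) \<le> w t"
          using X by (simp add: divide_le_eq)
      qed
    qed
    moreover have "((\<lambda>y. ((LINT t|M. K y t) - (LINT t|M. K x t)) /\<^sub>R (y - x)) \<circ> X) =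
        (\<lambda>i. LINT t|M. ?s i t)"
    proof
      fix i
      have "integrable M (K x)" "integrable M (K (X i))"
        using K V X by auto
      then show "((\<lambda>y. ((LINT t|M. K y t) - (LINT t|M. K x t)) /\<^sub>R (y - x)) \<circ> X) i = (LINT t|M. ?s i t)"
        by simp
    qed
    ultimately show "((\<lambda>y. ((LINT t|M. K y t) - (LINT t|M. K x t)) /\<^sub>R (y - x)) \<circ> X) \<longlonglongrightarrow> (LINT t|M. K' x t)"
      by (simp only:)
  qed
  then show ?thesis
    unfolding has_vector_derivative_iff_quotient at_within_open[OF V(3,1)] .
qed

section \<open>Integrability extracted from the L^p hypothesis\<close>

lemma integrable_one_plus_abs_powr:
  assumes "1 < q"
  shows "integrable lebesgue (\<lambda>t::real. (1 + \<bar>t\<bar>) powr (- q))"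
proof -
  define h :: "real \<Rightarrow> real" where "h t = indicator {1..} t * t powr (- q)" for t
  have [measurable]: "h \<in> borel_measurable borel"
    unfolding h_def by measurable
  have "(\<lambda>t::real. t powr (- q)) absolutely_integrable_on {1..}"
    using has_integral_powr_to_inf[of "- q" 1] assms
    by (intro nonnegative_absolutely_integrable_1) auto
  then have "integrable lebesgue h"
    by (simp add: set_integrable_def h_def[abs_def])
  then have "integrable lborel h"
    by (subst (asm) integrable_completion) auto
  \<comment> \<open>For \<open>t\<close> >= 0 the first summand is the target function, for
    \<open>t\<close> <= 0 the second is; since both are nonnegative, the sum is a majorant.\<close>
  then have "integrable lborel (\<lambda>t. h (1 + 1 * t) + h (1 + (-1) * t))"
    by (intro Bochner_Integration.integrable_add lborel_integrable_real_affine) auto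
  then have "integrable lborel (\<lambda>t::real. (1 + \<bar>t\<bar>) powr (- q))"
    by (rule Bochner_Integration.integrable_bound) (auto simp: h_def indicator_def abs_if)
  then show ?thesis
    by (subst integrable_completion) auto
qed

text \<open>The weight matches the decay of the Hilbert kernel away from its singularity. Apart from
  measurability, this is all that is later taken from the L^p hypothesis. For \<open>p = 1\<close>
  the weight is at most 1; otherwise Young's inequality with the conjugate exponent bounds the
  product by a sum of two integrable functions.\<close>

lemma Lp_real_integrable_div:
  assumes "1 \<le> p" "f \<in> Lp_real p"
  shows "integrable lebesgue (\<lambda>t. norm (f t) / (1 + \<bar>t\<bar>))"
proof -
  have m: "f \<in> borel_measurable lebesgue" and i: "integrable lebesgue (\<lambda>t. norm (f t) powr p)"
    using assms by (auto simp: Lp_real_def)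
  have [measurable]: "(\<lambda>t::real. 1 + \<bar>t\<bar>) \<in> borel_measurable lebesgue"
    by (rule measurable_completion) simp
  have m': "(\<lambda>t. norm (f t) / (1 + \<bar>t\<bar>)) \<in> borel_measurable lebesgue"
    using m by measurable
  show ?thesis
  proof (cases "p = 1")
    case True
    show ?thesis
    proof (rule Bochner_Integration.integrable_bound[OF i m'], rule AE_I2)
      fix t :: real
      have "norm (f t) / (1 + \<bar>t\<bar>) \<le> norm (f t)"
        by (simp add: divide_le_eq mult_le_cancel_left1)
      then show "norm (norm (f t) / (1 + \<bar>t\<bar>)) \<le> norm (norm (f t) powr p)"
        using True by simp
    qed
  next
    case False
    define q where "q = p / (p - 1)"
    have q: "p > 1" "q > 1" "1/p + 1/q = 1"
      using assms False by (auto simp: q_def field_simps)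
    have "integrable lebesgue (\<lambda>t. norm (f t) powr p / p + (1 + \<bar>t\<bar>) powr (- q) / q)"
      using i integrable_one_plus_abs_powr[OF q(2)] by simp
    then show ?thesis
    proof (rule Bochner_Integration.integrable_bound[OF _ m'], intro AE_I2)
      fix t :: real
      have "norm (f t) * (1 / (1 + \<bar>t\<bar>)) \<le> norm (f t) powr p / p + (1 / (1 + \<bar>t\<bar>)) powr q / q"
        by (rule Youngs_inequality[OF q]) auto
      also have "(1 / (1 + \<bar>t\<bar>)) powr q = (1 + \<bar>t\<bar>) powr (- q)"
        by (simp add: powr_divide powr_minus_divide)
      finally show "norm (norm (f t) / (1 + \<bar>t\<bar>)) \<le> norm (norm (f t) powr p / p + (1 + \<bar>t\<bar>) powr (- q) / q)"
        using q by simp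
    qed
  qed
qed

text \<open>By the triangle inequality 1 + |t| is at most |x - t| + (1 + |x|), and the second
  summand is absorbed because |x - t| / \<epsilon> is at least 1.\<close>

lemma inverse_abs_diff_le:
  fixes x t \<epsilon> :: real
  assumes "\<epsilon> > 0" "\<epsilon> \<le> \<bar>x - t\<bar>"
  shows "1 / \<bar>x - t\<bar> \<le> (1 + (1 + \<bar>x\<bar>) / \<epsilon>) / (1 + \<bar>t\<bar>)"
proof -
  have "1 + \<bar>t\<bar> \<le> \<bar>x - t\<bar> + (1 + \<bar>x\<bar>) * 1"
    using abs_triangle_ineq4[of x "x - t"] by simp
  also have "\<dots> \<le> \<bar>x - t\<bar> + (1 + \<bar>x\<bar>) * (\<bar>x - t\<bar> / \<epsilon>)"
    using assms by (intro add_left_mono mult_left_mono) auto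
  also have "\<dots> = (1 + (1 + \<bar>x\<bar>) / \<epsilon>) * \<bar>x - t\<bar>"
    by (simp add: algebra_simps)
  finally have le: "1 + \<bar>t\<bar> \<le> (1 + (1 + \<bar>x\<bar>) / \<epsilon>) * \<bar>x - t\<bar>" .
  have "1 / d \<le> c / e" if "e \<le> c * d" "0 < d" "0 < e" for c d e :: real
    using that by (simp add: pos_divide_le_eq pos_le_divide_eq mult.commute)
  from this[OF le] show ?thesis
    using assms by simp
qed

section \<open>Smoothness of integrals along chords\<close>

text \<open>The weight \<open>(1 - s) ^ j\<close> makes the family closed under differentiation in \<open>x\<close>: each
  derivative of \<open>h (x + s * (t - x))\<close> produces one factor \<open>1 - s\<close>.\<close>

definition chord_integral :: "real \<Rightarrow> real \<Rightarrow> nat \<Rightarrow> (real \<Rightarrow> complex) \<Rightarrow> real \<Rightarrow> complex" where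
  "chord_integral a b j h x =
     integral (cbox (a, 0) (b, 1)) (\<lambda>(t, s). (1 - s) ^ j *\<^sub>R h (x + s * (t - x)))"

lemma chord_mem:
  fixes x t s :: real
  assumes "convex U" "x \<in> U" "t \<in> U" "0 \<le> s" "s \<le> 1"
  shows "x + s * (t - x) \<in> U"
  using convexD_alt[OF assms(1-5)] by (simp add: algebra_simps)

lemma continuous_on_chord:
  fixes h :: "real \<Rightarrow> complex"
  assumes "convex U" "{a..b} \<subseteq> U" "continuous_on U h"
  shows "continuous_on (U \<times> cbox (a, 0) (b, 1))
    (\<lambda>(x, ts). case ts of (t, s) \<Rightarrow> (1 - s) ^ j *\<^sub>R h (x + s * (t - x)))"
proof -
  have "fst z + snd (snd z) * (fst (snd z) - fst z) \<in> U"
    if "z \<in> U \<times> cbox (a, 0) (b, 1)" for z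
    using that assms(2) by (intro chord_mem[OF assms(1)]) (auto simp: cbox_Pair_eq)
  then show ?thesis
    unfolding split_beta
    by (intro continuous_intros continuous_on_compose2[OF assms(3)]) auto
qed

lemma continuous_on_chord_fixed:
  fixes h :: "real \<Rightarrow> complex"
  assumes "convex U" "{a..b} \<subseteq> U" "x \<in> U" "continuous_on U h"
  shows "continuous_on (cbox (a, 0) (b, 1)) (\<lambda>(t, s). (1 - s) ^ j *\<^sub>R h (x + s * (t - x)))"
proof -
  have c: "continuous_on (Pair x ` cbox (a, 0) (b, 1))
      (\<lambda>(x, ts). case ts of (t, s) \<Rightarrow> (1 - s) ^ j *\<^sub>R h (x + s * (t - x)))"
    by (rule continuous_on_subset[OF continuous_on_chord[OF assms(1,2,4)]]) (use assms(3) in blast)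
  have "continuous_on (cbox (a, 0) (b, 1)) (Pair x)"
    by (intro continuous_intros)
  from continuous_on_compose[OF this c] show ?thesis
    by (simp only: o_def prod.case)
qed

text \<open>Leibniz's rule on a compact rectangle. Convexity of \<open>U\<close> keeps every point
  \<open>y + s * (t - y)\<close> in \<open>U\<close>, so the differentiated integrand is jointly
  continuous.\<close>

lemma chord_integral_has_vector_derivative:
  assumes U: "open U" "convex U" "{a..b} \<subseteq> U" and x: "x \<in> U"
    and d: "\<And>y. y \<in> U \<Longrightarrow> (h has_vector_derivative h' y) (at y)" and c: "continuous_on U h'"
  shows "(chord_integral a b j h has_vector_derivative chord_integral a b (Suc j) h' x) (at x)"
proof -
  have ch: "continuous_on U h"
    using d has_vector_derivative_continuous continuous_at_imp_continuous_on by blast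
  have "((\<lambda>x. integral (cbox (a, 0) (b, 1)) (\<lambda>(t, s). (1 - s) ^ j *\<^sub>R h (x + s * (t - x))))
      has_vector_derivative
      integral (cbox (a, 0) (b, 1)) (\<lambda>(t, s). (1 - s) ^ Suc j *\<^sub>R h' (x + s * (t - x)))) (at x within U)"
  proof (rule leibniz_rule_vector_derivative[OF _ _ continuous_on_chord[OF U(2,3) c] x U(2)])
    fix y and ts :: "real \<times> real"
    assume y: "y \<in> U" and ts: "ts \<in> cbox (a, 0) (b, 1)"
    obtain t s where ts_eq: "ts = (t, s)" by fastforce
    have "t \<in> U" "0 \<le> s" "s \<le> 1"
      using ts U(3) by (auto simp: ts_eq cbox_Pair_eq)
    then have "(h has_vector_derivative h' (y + s * (t - y))) (at (y + s * (t - y)))"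
      using chord_mem[OF U(2) y] d by blast
    moreover have "((\<lambda>y. y + s * (t - y)) has_vector_derivative 1 - s) (at y)"
      unfolding has_real_derivative_iff_has_vector_derivative[symmetric]
      by (auto intro!: derivative_eq_intros)
    ultimately have "((\<lambda>y. h (y + s * (t - y))) has_vector_derivative (1 - s) *\<^sub>R h' (y + s * (t - y))) (at y)"
      using vector_diff_chain_at[of "\<lambda>y. y + s * (t - y)" "1 - s" y h] by (simp add: o_def)
    then have "((\<lambda>y. (1 - s) ^ j *\<^sub>R h (y + s * (t - y))) has_vector_derivative
        (1 - s) ^ j *\<^sub>R ((1 - s) *\<^sub>R h' (y + s * (t - y)))) (at y)"
      by (rule bounded_linear.has_vector_derivative[OF bounded_linear_scaleR_right])
    then have "((\<lambda>y. (1 - s) ^ j *\<^sub>R h (y + s * (t - y))) has_vector_derivative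
        (1 - s) ^ Suc j *\<^sub>R h' (y + s * (t - y))) (at y)"
      by (simp add: mult.commute)
    from has_vector_derivative_at_within[OF this]
    show "((\<lambda>y. case ts of (t, s) \<Rightarrow> (1 - s) ^ j *\<^sub>R h (y + s * (t - y))) has_vector_derivative
        (case ts of (t, s) \<Rightarrow> (1 - s) ^ Suc j *\<^sub>R h' (y + s * (t - y)))) (at y within U)"
      unfolding ts_eq prod.case .
  next
    fix y assume y: "y \<in> U"
    show "(\<lambda>(t, s). (1 - s) ^ j *\<^sub>R h (y + s * (t - y))) integrable_on cbox (a, 0) (b, 1)"
      by (intro integrable_continuous continuous_on_chord_fixed[OF U(2,3) y ch])
  qed
  then show ?thesis
    by (simp only: chord_integral_def[abs_def] at_within_open[OF x U(1)])
qed

text \<open>The induction runs over all \<open>j\<close> and \<open>h\<close> at once, since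
  differentiating replaces \<open>h\<close> by its derivative and \<open>j\<close> by
  \<open>Suc j\<close>. Averaging over chords thus costs no order of smoothness.\<close>

lemma Ck_on_chord_integral:
  assumes U: "open U" "convex U" "{a..b} \<subseteq> U" and "Ck_on k h U"
  shows "Ck_on k (chord_integral a b j h) U"
  using assms(4)
proof (induction k arbitrary: j h)
  case 0
  then show ?case
    using integral_continuous_on_param[OF continuous_on_chord[OF U(2,3), of h j]]
    by (simp add: chord_integral_def[abs_def])
next
  case (Suc k)
  let ?h' = "\<lambda>x. vector_derivative h (at x)"
  have h': "Ck_on k ?h' U"
    using Suc.prems by simp
  have "continuous_on U ?h'"
    using h' Ck_on_imp_continuous_on by blast
  then show ?case
    by (intro Ck_on_SucI[OF U(1) _ Suc.IH[OF h', of "Suc j"]] chord_integral_has_vector_derivative[OF U]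
        Ck_on_Suc_has_vector_derivative[OF Suc.prems])
qed

section \<open>Inverse powers and the logarithmic factor\<close>

text \<open>The numerator \<open>z\<close> stays general because it is 1 for the smoothness of
  inverse powers and \<open>f t\<close> for the integral kernel. The complex derivative is computed
  first and then restricted to the real line.\<close>

lemma has_vector_derivative_inverse_power:
  assumes "x \<noteq> c"
  shows "((\<lambda>x. z / complex_of_real (x - c) ^ n) has_vector_derivative
    - of_nat n * (z / complex_of_real (x - c) ^ Suc n)) (at x)"
proof (cases n)
  case 0
  then show ?thesis by simp
next
  case (Suc m)
  have "((\<lambda>w. z / (w - complex_of_real c) ^ n) has_field_derivative
      - of_nat n * (z / (complex_of_real x - complex_of_real c) ^ Suc n)) (at (complex_of_real x))"
    using assms Suc
    by (auto intro!: derivative_eq_intros simp: divide_simps)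
      (cases m; simp add: algebra_simps)
  from has_vector_derivative_real_field[OF this] show ?thesis
    by (simp only: of_real_diff)
qed

lemma Ck_on_inverse_power:
  assumes "open U" "c \<notin> U"
  shows "Ck_on k (\<lambda>x. 1 / complex_of_real (x - c) ^ n) U"
proof (induction k arbitrary: n)
  case 0
  then show ?case
    using assms by (auto intro!: continuous_intros)
next
  case (Suc k)
  have d: "((\<lambda>x. 1 / complex_of_real (x - c) ^ n) has_vector_derivative
      - of_nat n * (1 / complex_of_real (x - c) ^ Suc n)) (at x)" if "x \<in> U" for x
    by (rule has_vector_derivative_inverse_power) (use assms that in auto)
  show ?case
    by (rule Ck_on_SucI[OF assms(1) d], assumption)
      (rule Ck_on_mult[OF assms(1) Ck_on_const Suc.IH])
qed

lemma Ck_on_ln_ratio: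
  assumes "open U" "U \<subseteq> {a<..<b}"
  shows "Ck_on k (\<lambda>x. complex_of_real (ln (x - a) - ln (b - x))) U"
\<comment> \<open>One order more is proved and then dropped, so \<open>k = 0\<close> needs no
  separate continuity argument: for every \<open>k\<close> only the derivative, a sum of inverse
  powers, has to be examined.\<close>
proof (rule Ck_on_SucD, rule Ck_on_SucI[OF assms(1)])
  fix x assume "x \<in> U"
  then have x: "a < x" "x < b" using assms by auto
  have "((\<lambda>x. ln (x - a) - ln (b - x)) has_real_derivative 1 / (x - a) + 1 / (b - x)) (at x)"
    using x by (auto intro!: derivative_eq_intros simp: field_simps)
  then have "((\<lambda>x. complex_of_real (ln (x - a) - ln (b - x))) has_vector_derivative
      complex_of_real (1 / (x - a) + 1 / (b - x))) (at x)"
    by (intro has_vector_derivative_of_real) (simp add: has_real_derivative_iff_has_vector_derivative)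
  also have "complex_of_real (1 / (x - a) + 1 / (b - x)) =
      1 / complex_of_real (x - a) ^ 1 + (- 1) * (1 / complex_of_real (x - b) ^ 1)"
    using x by (simp add: divide_simps) (simp add: algebra_simps)
  finally show "((\<lambda>x. complex_of_real (ln (x - a) - ln (b - x))) has_vector_derivative
      1 / complex_of_real (x - a) ^ 1 + (- 1) * (1 / complex_of_real (x - b) ^ 1)) (at x)" .
next
  have "a \<notin> U" "b \<notin> U" using assms(2) by auto
  then show "Ck_on k (\<lambda>x. 1 / complex_of_real (x - a) ^ 1 + (- 1) * (1 / complex_of_real (x - b) ^ 1)) U"
    by (intro Ck_on_add Ck_on_mult Ck_on_const Ck_on_inverse_power assms(1))
qed

section \<open>Cauchy-type integrals over a set away from the singularity\<close>

context
  fixes f :: "real \<Rightarrow> complex" and E :: "real set"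
  assumes f: "f \<in> borel_measurable lebesgue" "integrable lebesgue (\<lambda>t. norm (f t) / (1 + \<bar>t\<bar>))"
    and E: "E \<in> sets lebesgue"
begin

text \<open>One of the \<open>Suc n\<close> factors supplies the decay in \<open>t\<close>; each of
  the other \<open>n\<close> is bounded by 1 / \<epsilon>. Bounding |x| by \<open>m\<close> makes
  the majorant uniform in \<open>x\<close>, as differentiation under the integral requires.\<close>

lemma norm_cauchy_kernel_le:
  assumes "0 < \<epsilon>" "\<And>t. t \<in> E \<Longrightarrow> \<epsilon> \<le> \<bar>x - t\<bar>" "\<bar>x\<bar> \<le> m"
  shows "norm (indicator E t *\<^sub>R (f t / complex_of_real (x - t) ^ Suc n)) \<le>
    (1 + (1 + m) / \<epsilon>) / \<epsilon> ^ n * (norm (f t) / (1 + \<bar>t\<bar>))"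
proof (cases "t \<in> E")
  case True
  have "1 / \<bar>x - t\<bar> ^ Suc n = 1 / \<bar>x - t\<bar> * (1 / \<bar>x - t\<bar>) ^ n"
    by (simp add: power_one_over)
  also have "\<dots> \<le> (1 + (1 + m) / \<epsilon>) / (1 + \<bar>t\<bar>) * (1 / \<epsilon>) ^ n"
  proof (intro mult_mono power_mono)
    have "1 / \<bar>x - t\<bar> \<le> (1 + (1 + \<bar>x\<bar>) / \<epsilon>) / (1 + \<bar>t\<bar>)"
      using True assms by (intro inverse_abs_diff_le) auto
    also have "\<dots> \<le> (1 + (1 + m) / \<epsilon>) / (1 + \<bar>t\<bar>)"
      using assms by (intro divide_right_mono add_left_mono) auto
    finally show "1 / \<bar>x - t\<bar> \<le> (1 + (1 + m) / \<epsilon>) / (1 + \<bar>t\<bar>)" .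
    show "1 / \<bar>x - t\<bar> \<le> 1 / \<epsilon>"
      using True assms by (intro divide_left_mono mult_pos_pos) force+
  qed (use assms in auto)
  finally have "norm (f t) * (1 / \<bar>x - t\<bar> ^ Suc n) \<le>
      norm (f t) * ((1 + (1 + m) / \<epsilon>) / (1 + \<bar>t\<bar>) * (1 / \<epsilon>) ^ n)"
    by (rule mult_left_mono) simp
  then show ?thesis
    using True by (simp add: norm_divide norm_power norm_mult power_one_over mult_ac flip: of_real_diff)
qed (use assms in auto)

lemma cauchy_kernel_borel_measurable:
  "(\<lambda>t. indicator E t *\<^sub>R (f t / complex_of_real (x - t) ^ n)) \<in> borel_measurable lebesgue"
proof -
  have [measurable]: "(\<lambda>t. complex_of_real (x - t) ^ n) \<in> borel_measurable lebesgue"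
    by (rule measurable_completion) simp
  show ?thesis
    using f(1) E by measurable
qed

lemma set_integrable_cauchy_kernel:
  assumes "0 < \<epsilon>" "\<And>t. t \<in> E \<Longrightarrow> \<epsilon> \<le> \<bar>x - t\<bar>"
  shows "set_integrable lebesgue E (\<lambda>t. f t / complex_of_real (x - t) ^ Suc n)"
  unfolding set_integrable_def
proof (rule Bochner_Integration.integrable_bound[OF _ cauchy_kernel_borel_measurable])
  let ?c = "(1 + (1 + \<bar>x\<bar>) / \<epsilon>) / \<epsilon> ^ n"
  show "integrable lebesgue (\<lambda>t. ?c * (norm (f t) / (1 + \<bar>t\<bar>)))"
    by (intro integrable_mult_right f(2))
  show "AE t in lebesgue. norm (indicator E t *\<^sub>R (f t / complex_of_real (x - t) ^ Suc n)) \<le>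
      norm (?c * (norm (f t) / (1 + \<bar>t\<bar>)))"
    unfolding real_norm_def
    by (intro AE_I2 order_trans[OF norm_cauchy_kernel_le[OF assms order_refl] abs_ge_self])
qed

text \<open>Points of \<open>E\<close> are at distance at least \<open>2 * r\<close> from
  \<open>x0\<close>, hence at least \<open>r\<close> from every point of the ball, so one integrable
  majorant serves the whole ball.\<close>

lemma cauchy_integral_has_vector_derivative:
  assumes r: "0 < r" "\<And>t. t \<in> E \<Longrightarrow> 2 * r \<le> \<bar>x0 - t\<bar>" and x: "x \<in> ball x0 r"
  shows "((\<lambda>x. LINT t:E|lebesgue. f t / complex_of_real (x - t) ^ Suc n) has_vector_derivative
    - of_nat (Suc n) * (LINT t:E|lebesgue. f t / complex_of_real (x - t) ^ Suc (Suc n))) (at x)"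
proof -
  have E': "r \<le> \<bar>y - t\<bar>" if "t \<in> E" "y \<in> ball x0 r" for y t
    using r(2)[OF that(1)] that(2) by (auto simp: dist_real_def)
  let ?K = "\<lambda>n y t. indicator E t *\<^sub>R (f t / complex_of_real (y - t) ^ n)"
  \<comment> \<open>The constant of \<open>norm_cauchy_kernel_le\<close> for distance
    \<open>r\<close>, \<open>m\<close> = |x0| + r and exponent \<open>Suc (Suc n)\<close>.\<close>
  let ?c = "(1 + (1 + (\<bar>x0\<bar> + r)) / r) / r ^ Suc n"
  have "((\<lambda>y. LINT t|lebesgue. ?K (Suc n) y t) has_vector_derivative
      (LINT t|lebesgue. - of_nat (Suc n) * ?K (Suc (Suc n)) x t)) (at x)"
  proof (rule has_vector_derivative_lebesgue_integral[OF _ _ x])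
    show "integrable lebesgue (?K (Suc n) y)" if "y \<in> ball x0 r" for y
      using set_integrable_cauchy_kernel[OF r(1) E'[OF _ that]] by (simp add: set_integrable_def)
    show "(\<lambda>t. - of_nat (Suc n) * ?K (Suc (Suc n)) x t) \<in> borel_measurable lebesgue"
      by (intro borel_measurable_times borel_measurable_const cauchy_kernel_borel_measurable)
    show "((\<lambda>y. ?K (Suc n) y t) has_vector_derivative - of_nat (Suc n) * ?K (Suc (Suc n)) y t) (at y)"
      if "y \<in> ball x0 r" for y t
    proof (cases "t \<in> E")
      case True
      then have "y \<noteq> t" using E'[OF True that] r(1) by auto
      from has_vector_derivative_inverse_power[OF this, of "f t" "Suc n"] True show ?thesis by simp
    qed simp
    show "integrable lebesgue (\<lambda>t. real (Suc n) * (?c * (norm (f t) / (1 + \<bar>t\<bar>))))"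
      by (intro integrable_mult_right f(2))
    show "norm (- of_nat (Suc n) * ?K (Suc (Suc n)) y t) \<le> real (Suc n) * (?c * (norm (f t) / (1 + \<bar>t\<bar>)))"
      if "y \<in> ball x0 r" for y t
    proof -
      have "\<bar>y\<bar> \<le> \<bar>x0\<bar> + r"
        using that by (auto simp: dist_real_def)
      from norm_cauchy_kernel_le[OF r(1) E'[OF _ that] this, of t "Suc n"]
      show ?thesis
        unfolding norm_mult norm_minus_cancel norm_of_nat by (intro mult_left_mono) auto
    qed
  qed auto
  then show ?thesis
    unfolding set_lebesgue_integral_def integral_mult_right_zero .
qed

text \<open>Each derivative is a constant multiple of the same integral with a higher power, so the
  induction is over all \<open>n\<close> at once.\<close>

lemma Ck_on_cauchy_integral:
  assumes r: "0 < r" "\<And>t. t \<in> E \<Longrightarrow> 2 * r \<le> \<bar>x0 - t\<bar>"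
  shows "Ck_on k (\<lambda>x. LINT t:E|lebesgue. f t / complex_of_real (x - t) ^ Suc n) (ball x0 r)"
proof (induction k arbitrary: n)
  case 0
  have "isCont (\<lambda>x. LINT t:E|lebesgue. f t / complex_of_real (x - t) ^ Suc n) x" if "x \<in> ball x0 r" for x
    using has_vector_derivative_continuous[OF cauchy_integral_has_vector_derivative[OF r that]] .
  then show ?case
    unfolding Ck_on.simps by (intro continuous_at_imp_continuous_on ballI)
next
  case (Suc k)
  show ?case
  proof (rule Ck_on_SucI[OF open_ball cauchy_integral_has_vector_derivative[OF r]])
    show "Ck_on k (\<lambda>x. - of_nat (Suc n) * (LINT t:E|lebesgue. f t / complex_of_real (x - t) ^ Suc (Suc n)))
        (ball x0 r)"
      by (rule Ck_on_mult[OF open_ball Ck_on_const Suc.IH])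
  qed
qed

end

section \<open>The principal value inside the window\<close>

lemma truncated_near_integral:
  fixes f :: "real \<Rightarrow> complex"
  assumes x: "0 < \<epsilon>" "\<epsilon> < x - a" "\<epsilon> < b - x"
    and f: "\<And>t. t \<in> {a..b} \<Longrightarrow> f t - f x = complex_of_real (t - x) * g t"
    and g: "continuous_on {a..b} g"
  shows "((\<lambda>t. f t / complex_of_real (x - t)) has_integral
      f x * complex_of_real (ln (x - a) - ln (b - x)) - integral {a..x - \<epsilon>} g - integral {x + \<epsilon>..b} g)
      {t \<in> {a..b}. \<epsilon> < \<bar>x - t\<bar>}"
proof -
  \<comment> \<open>Dividing by \<open>x - t\<close> turns \<open>(t - x) * g t\<close> into
    \<open>- g t\<close>, so only the constant \<open>f x\<close> still meets the singular
    kernel.\<close>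
  let ?k = "\<lambda>t. f x * complex_of_real (1 / (x - t)) - g t"
  have eq: "?k t = f t / complex_of_real (x - t)" if "t \<in> {a..b}" "t \<noteq> x" for t
  proof -
    have "f t = f x + complex_of_real (t - x) * g t"
      using f[OF that(1)] by (simp add: algebra_simps)
    then show ?thesis
      using that(2) by (simp add: field_simps)
  qed
  have gi: "(g has_integral integral {c..d} g) {c..d}" if "{c..d} \<subseteq> {a..b}" for c d
    using continuous_on_subset[OF g that] integrable_continuous_interval integrable_integral by blast
  have 1: "((\<lambda>t. 1 / (x - t)) has_integral - ln (x - (x - \<epsilon>)) - (- ln (x - a))) {a..x - \<epsilon>}"
    using x by (intro fundamental_theorem_of_calculus[where f = "\<lambda>t. - ln (x - t)"])
      (auto intro!: derivative_eq_intros simp flip: has_real_derivative_iff_has_vector_derivative)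
  have 2: "((\<lambda>t. 1 / (x - t)) has_integral - ln (b - x) - (- ln (x + \<epsilon> - x))) {x + \<epsilon>..b}"
    using x by (intro fundamental_theorem_of_calculus[where f = "\<lambda>t. - ln (t - x)"])
      (auto intro!: derivative_eq_intros simp: field_simps simp flip: has_real_derivative_iff_has_vector_derivative)
  have "(?k has_integral f x * complex_of_real (- ln (x - (x - \<epsilon>)) - (- ln (x - a))) - integral {a..x - \<epsilon>} g) {a..x - \<epsilon>}"
    using x by (intro has_integral_diff has_integral_mult_right has_integral_of_real 1 gi) auto
  moreover have "(?k has_integral f x * complex_of_real (- ln (b - x) - (- ln (x + \<epsilon> - x))) - integral {x + \<epsilon>..b} g) {x + \<epsilon>..b}"
    using x by (intro has_integral_diff has_integral_mult_right has_integral_of_real 2 gi) auto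
  ultimately have "(?k has_integral
      (f x * complex_of_real (- ln (x - (x - \<epsilon>)) - (- ln (x - a))) - integral {a..x - \<epsilon>} g) +
      (f x * complex_of_real (- ln (b - x) - (- ln (x + \<epsilon> - x))) - integral {x + \<epsilon>..b} g))
      ({a..x - \<epsilon>} \<union> {x + \<epsilon>..b})"
    using x by (intro has_integral_Un) auto
  \<comment> \<open>The left piece contributes - ln \<epsilon> and the right piece + ln \<epsilon>;
    this cancellation is what makes the principal value finite.\<close>
  then have "(?k has_integral
      f x * complex_of_real (ln (x - a) - ln (b - x)) - integral {a..x - \<epsilon>} g - integral {x + \<epsilon>..b} g)
      ({a..x - \<epsilon>} \<union> {x + \<epsilon>..b})"
    by (rule back_subst[of "\<lambda>I. (?k has_integral I) _"]) (simp add: algebra_simps)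
  \<comment> \<open>The closed pieces and the strict truncation differ only in these two
    endpoints.\<close>
  moreover have "negligible {x - \<epsilon>, x + \<epsilon>}" by simp
  ultimately have "(?k has_integral
      f x * complex_of_real (ln (x - a) - ln (b - x)) - integral {a..x - \<epsilon>} g - integral {x + \<epsilon>..b} g)
      {t \<in> {a..b}. \<epsilon> < \<bar>x - t\<bar>}"
    by (rule iffD1[OF has_integral_spike_set_eq[OF negligible_subset negligible_subset], rotated 4])
      (use x in \<open>auto simp: abs_if split: if_splits\<close>)
  then show ?thesis
    by (rule has_integral_eq[rotated]) (use x eq in \<open>auto simp del: of_real_diff\<close>)
qed

lemma truncated_near_integral_limit:
  fixes g :: "real \<Rightarrow> complex"
  assumes x: "a < x" "x < b" and g: "continuous_on {a..b} g"
  shows "((\<lambda>\<epsilon>. integral {a..x - \<epsilon>} g + integral {x + \<epsilon>..b} g) \<longlongrightarrow> integral {a..b} g) (at_right 0)"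
proof -
  have gi: "g integrable_on {a..b}"
    using g integrable_continuous_interval by blast
  have "isCont (\<lambda>y. integral {a..y} g) x" "isCont (\<lambda>y. integral {y..b} g) x"
    using indefinite_integral_continuous_1[OF gi] indefinite_integral_continuous_1'[OF gi] x
    by (auto simp: continuous_on_interior)
  moreover have "((\<lambda>\<epsilon>. x - \<epsilon>) \<longlongrightarrow> x) (at_right 0)" "((\<lambda>\<epsilon>. x + \<epsilon>) \<longlongrightarrow> x) (at_right 0)"
    by (auto intro!: tendsto_eq_intros)
  ultimately have "((\<lambda>\<epsilon>. integral {a..x - \<epsilon>} g + integral {x + \<epsilon>..b} g) \<longlongrightarrow> integral {a..x} g + integral {x..b} g) (at_right 0)"
    by (intro tendsto_add isCont_tendsto_compose[of x "\<lambda>y. integral {a..y} g"]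
        isCont_tendsto_compose[of x "\<lambda>y. integral {y..b} g"])
  then show ?thesis
    using Henstock_Kurzweil_Integration.integral_combine[OF _ _ gi, of x] x by simp
qed

text \<open>The fundamental theorem of calculus along the segment from \<open>x\<close> to
  \<open>t\<close>. The product form avoids division by \<open>t - x\<close>, so it also covers
  \<open>t = x\<close> and either order of the two points.\<close>

lemma chord_quotient:
  fixes f :: "real \<Rightarrow> complex"
  assumes U: "convex U" "x \<in> U" "t \<in> U"
    and d: "\<And>y. y \<in> U \<Longrightarrow> (f has_vector_derivative f' y) (at y)"
  shows "f t - f x = complex_of_real (t - x) * integral {0..1} (\<lambda>s. f' (x + s * (t - x)))"
proof -
  have "((\<lambda>s. (t - x) *\<^sub>R f' (x + s * (t - x))) has_integral
      f (x + 1 * (t - x)) - f (x + 0 * (t - x))) {0..1}"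
  proof (rule fundamental_theorem_of_calculus)
    fix s :: real
    assume s: "s \<in> {0..1}"
    have "((\<lambda>s. x + s * (t - x)) has_vector_derivative t - x) (at s)"
      unfolding has_real_derivative_iff_has_vector_derivative[symmetric]
      by (auto intro!: derivative_eq_intros)
    moreover have "(f has_vector_derivative f' (x + s * (t - x))) (at (x + s * (t - x)))"
      using s by (intro d chord_mem U) auto
    ultimately have "((\<lambda>s. f (x + s * (t - x))) has_vector_derivative (t - x) *\<^sub>R f' (x + s * (t - x))) (at s)"
      using vector_diff_chain_at[of "\<lambda>s. x + s * (t - x)" "t - x" s f] by (simp add: o_def)
    then show "((\<lambda>s. f (x + s * (t - x))) has_vector_derivative (t - x) *\<^sub>R f' (x + s * (t - x))) (at s within {0..1})"
      by (rule has_vector_derivative_at_within)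
  qed simp
  from integral_unique[OF this] show ?thesis
    by (simp add: scaleR_conv_of_real flip: of_real_diff)
qed

section \<open>The decomposition of the Hilbert transform and its smoothness\<close>

text \<open>The value of the principal value integral once a window is fixed. The exponent
  \<open>Suc 0\<close> and the factor \<open>- 1\<close> give the terms the shape to which the
  \<open>Ck_on\<close> rules for Cauchy integrals, sums and products apply directly.\<close>

definition hilbert_decomposition :: "real \<Rightarrow> real \<Rightarrow> (real \<Rightarrow> complex) \<Rightarrow> real \<Rightarrow> complex" where
  "hilbert_decomposition a b f x =
     complex_of_real (1 / pi) *
       ((LINT t:- {a..b}|lebesgue. f t / complex_of_real (x - t) ^ Suc 0) +
        (f x * complex_of_real (ln (x - a) - ln (b - x)) +
         (- 1) * chord_integral a b 0 (\<lambda>y. vector_derivative f (at y)) x))"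

context
  fixes p :: real and f :: "real \<Rightarrow> complex"
  assumes p: "1 \<le> p" and f: "f \<in> Lp_real p"
begin

lemma set_integrable_hilbert_kernel:
  assumes "0 < \<epsilon>" "E \<in> sets lebesgue" "\<And>t. t \<in> E \<Longrightarrow> \<epsilon> \<le> \<bar>x - t\<bar>"
  shows "set_integrable lebesgue E (\<lambda>t. f t / complex_of_real (x - t))"
  using set_integrable_cauchy_kernel[OF _ Lp_real_integrable_div[OF p f] assms(2,1,3), of 0] f
  by (simp add: Lp_real_def)

text \<open>Once \<epsilon> is small enough for the excised interval to lie inside the window, the
  truncated transform equals an expression in which only the integrals of the continuous
  \<open>g\<close> depend on \<epsilon>.\<close>

lemma truncated_hilbert_tendsto:
  assumes U: "convex U" "{a..b} \<subseteq> U" and x: "a < x" "x < b" and C1: "Ck_on (Suc 0) f U"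
  shows "(truncated_hilbert f x \<longlongrightarrow> hilbert_decomposition a b f x) (at_right 0)"
proof -
  define f' where "f' = (\<lambda>y. vector_derivative f (at y))"
  define g where "g = (\<lambda>t. integral {0..1} (\<lambda>s. f' (x + s * (t - x))))"
  define F where "F = (LINT t:- {a..b}|lebesgue. f t / complex_of_real (x - t))"
  define c where "c = f x * complex_of_real (ln (x - a) - ln (b - x))"
  have xU: "x \<in> U" using U x by auto
  have f': "continuous_on U f'"
    using C1 by (simp add: f'_def)
  have g_eq: "f t - f x = complex_of_real (t - x) * g t" if "t \<in> {a..b}" for t
    unfolding g_def
    by (rule chord_quotient[OF U(1) xU])
      (use U(2) that Ck_on_Suc_has_vector_derivative[OF C1] in \<open>auto simp: f'_def\<close>)
  note cont = continuous_on_chord_fixed[OF U xU f', of 0]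
  have "continuous_on ({a..b} \<times> cbox 0 1) (\<lambda>(t, s). f' (x + s * (t - x)))"
    using cont by (simp add: cbox_Pair_eq)
  from integral_continuous_on_param[OF this] have g: "continuous_on {a..b} g"
    by (simp add: g_def)
  \<comment> \<open>Fubini on the rectangle: \<open>g\<close> is the inner integral over
    \<open>s\<close>.\<close>
  have chord: "chord_integral a b 0 f' x = integral {a..b} g"
    using integral_prod_continuous[OF cont] by (simp add: chord_integral_def g_def)
  have "\<forall>\<^sub>F \<epsilon> in at_right 0. \<epsilon> \<in> {0<..<min (x - a) (b - x)}"
    by (rule eventually_at_right_real) (use x in auto)
  then have ev: "\<forall>\<^sub>F \<epsilon> in at_right 0.
      complex_of_real (1 / pi) * (F + (c - (integral {a..x - \<epsilon>} g + integral {x + \<epsilon>..b} g))) = truncated_hilbert f x \<epsilon>"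
  proof eventually_elim
    case (elim \<epsilon>)
    let ?k = "\<lambda>t. f t / complex_of_real (x - t)" and ?N = "{t \<in> {a..b}. \<epsilon> < \<bar>x - t\<bar>}"
    have eps: "0 < \<epsilon>" "\<epsilon> < x - a" "\<epsilon> < b - x" using elim by auto
    have N: "?N = {a..<x - \<epsilon>} \<union> {x + \<epsilon><..b}"
      using eps by auto
    have iN: "set_integrable lebesgue ?N ?k"
      by (rule set_integrable_hilbert_kernel[OF eps(1)]) (auto simp: N)
    have iE: "set_integrable lebesgue (- {a..b}) ?k"
      by (rule set_integrable_hilbert_kernel[OF eps(1)]) (use eps in auto)
    have "{t. \<bar>x - t\<bar> > \<epsilon>} = - {a..b} \<union> ?N"
      using eps by auto
    then have "truncated_hilbert f x \<epsilon> = complex_of_real (1 / pi) * (LINT t:- {a..b} \<union> ?N|lebesgue. ?k t)"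
      by (simp add: truncated_hilbert_def)
    also have "(LINT t:- {a..b} \<union> ?N|lebesgue. ?k t) = F + (LINT t:?N|lebesgue. ?k t)"
      unfolding F_def by (rule set_integral_Un[OF _ iE iN]) auto
    \<comment> \<open>Passing to the gauge integral makes the value computed by antiderivatives
      available.\<close>
    also have "(LINT t:?N|lebesgue. ?k t) = integral ?N ?k"
      by (rule set_lebesgue_integral_eq_integral(2)[OF iN])
    also have "\<dots> = c - integral {a..x - \<epsilon>} g - integral {x + \<epsilon>..b} g"
      unfolding c_def by (rule integral_unique[OF truncated_near_integral[OF eps g_eq g]])
    finally show ?case by simp
  qed
  have "((\<lambda>\<epsilon>. complex_of_real (1 / pi) * (F + (c - (integral {a..x - \<epsilon>} g + integral {x + \<epsilon>..b} g)))) \<longlongrightarrow>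
      complex_of_real (1 / pi) * (F + (c - integral {a..b} g))) (at_right 0)"
    by (intro tendsto_intros truncated_near_integral_limit x g)
  moreover have "complex_of_real (1 / pi) * (F + (c - integral {a..b} g)) = hilbert_decomposition a b f x"
    by (simp add: hilbert_decomposition_def F_def c_def chord[symmetric] f'_def)
  ultimately show ?thesis
    using Lim_transform_eventually[OF _ ev] by simp
qed

lemma hilbert_transform_Ck_on_ball:
  assumes r: "0 < r" and Ck: "Ck_on (Suc k) f (ball x0 (3 * r))"
  shows "\<forall>x\<in>ball x0 r. hilbert_pv_exists f x" "Ck_on k (hilbert_transform f) (ball x0 r)"
proof -
  \<comment> \<open>Half-width \<open>2 * r\<close> serves both sides: points outside the window
    keep the distance from \<open>x0\<close> that the Cauchy integral needs, and the closed window
    still lies in the ball of radius \<open>3 * r\<close> where \<open>f\<close> is smooth.\<close>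
  define a b where "a = x0 - 2 * r" and "b = x0 + 2 * r"
  have U: "open (ball x0 (3 * r))" "convex (ball x0 (3 * r))" "{a..b} \<subseteq> ball x0 (3 * r)"
    using r by (auto simp: a_def b_def dist_real_def)
  have sub: "ball x0 r \<subseteq> ball x0 (3 * r)" and ab: "ball x0 r \<subseteq> {a<..<b}"
    using r by (auto simp: a_def b_def dist_real_def)
  have "Ck_on (Suc 0) f (ball x0 (3 * r))"
    using Ck Ck_on_imp_continuous_on[of k] by simp
  then have lim: "(truncated_hilbert f x \<longlongrightarrow> hilbert_decomposition a b f x) (at_right 0)"
    if "x \<in> ball x0 r" for x
    using ab that by (intro truncated_hilbert_tendsto[OF U(2,3)]) auto
  show "\<forall>x\<in>ball x0 r. hilbert_pv_exists f x"
    unfolding hilbert_pv_exists_def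
  proof (intro ballI conjI allI impI exI)
    fix x \<epsilon> :: real
    assume "\<epsilon> > 0"
    moreover from this have "{t. \<bar>x - t\<bar> > \<epsilon>} = {..<x - \<epsilon>} \<union> {x + \<epsilon><..}"
      by auto
    then have "{t. \<bar>x - t\<bar> > \<epsilon>} \<in> sets lebesgue"
      by simp
    ultimately show "set_integrable lebesgue {t. \<bar>x - t\<bar> > \<epsilon>} (\<lambda>t. f t / complex_of_real (x - t))"
      by (intro set_integrable_hilbert_kernel) auto
  qed (rule lim)
  have "Ck_on k (hilbert_decomposition a b f) (ball x0 r)"
    unfolding hilbert_decomposition_def[abs_def]
  proof (intro Ck_on_mult Ck_on_add Ck_on_const open_ball)
    have "f \<in> borel_measurable lebesgue"
      using f by (simp add: Lp_real_def)
    then show "Ck_on k (\<lambda>x. LINT t:- {a..b}|lebesgue. f t / complex_of_real (x - t) ^ Suc 0) (ball x0 r)"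
      by (rule Ck_on_cauchy_integral[OF _ Lp_real_integrable_div[OF p f] _ r])
        (auto simp: a_def b_def)
    show "Ck_on k f (ball x0 r)"
      by (rule Ck_on_subset[OF Ck_on_SucD[OF Ck] sub])
    show "Ck_on k (\<lambda>x. complex_of_real (ln (x - a) - ln (b - x))) (ball x0 r)"
      by (rule Ck_on_ln_ratio[OF open_ball ab])
    \<comment> \<open>Among the terms of the decomposition, this is the one that consumes the extra
      derivative of \<open>f\<close>.\<close>
    have "Ck_on k (\<lambda>y. vector_derivative f (at y)) (ball x0 (3 * r))"
      using Ck by simp
    then show "Ck_on k (chord_integral a b 0 (\<lambda>y. vector_derivative f (at y))) (ball x0 r)"
      by (rule Ck_on_subset[OF Ck_on_chord_integral[OF U] sub])
  qed
  \<comment> \<open>The limit exists at these points, so \<open>Lim\<close> has this value and not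
    its unspecified default.\<close>
  moreover have "hilbert_decomposition a b f x = hilbert_transform f x" if "x \<in> ball x0 r" for x
    unfolding hilbert_transform_def by (rule tendsto_Lim[OF _ lim[OF that], symmetric]) simp
  ultimately show "Ck_on k (hilbert_transform f) (ball x0 r)"
    using Ck_on_cong[OF open_ball] by blast
qed

end

theorem corollary1p2:
  fixes p :: real and f :: "real \<Rightarrow> complex" and x0 :: real
  assumes "1 \<le> p" and "f \<in> Lp_real p"
  shows "(\<forall>k::nat.
            (\<exists>U. open U \<and> x0 \<in> U \<and> Ck_on (k + 1) f U) \<longrightarrow>
            (\<exists>V. open V \<and> x0 \<in> V \<and> (\<forall>x\<in>V. hilbert_pv_exists f x) \<and>
                 Ck_on k (hilbert_transform f) V)) \<and>
         ((\<exists>U. open U \<and> x0 \<in> U \<and> Cinf_on f U) \<longrightarrow>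
          (\<exists>V. open V \<and> x0 \<in> V \<and> (\<forall>x\<in>V. hilbert_pv_exists f x) \<and>
               Cinf_on (hilbert_transform f) V))"
proof -
  have ball: "\<exists>r>0. ball x0 (3 * r) \<subseteq> U" if "open U" "x0 \<in> U" for U
  proof -
    obtain e where "e > 0" "ball x0 e \<subseteq> U"
      using \<open>open U\<close> \<open>x0 \<in> U\<close> openE by blast
    then show ?thesis
      by (intro exI[of _ "e / 3"]) simp
  qed
  note local = hilbert_transform_Ck_on_ball[OF assms]
  show ?thesis
  proof (intro conjI allI impI; elim exE conjE)
    fix k U
    assume U: "open U" "x0 \<in> U" "Ck_on (k + 1) f U"
    obtain r where r: "r > 0" "ball x0 (3 * r) \<subseteq> U"
      using ball[OF U(1,2)] by blast
    have "Ck_on (Suc k) f (ball x0 (3 * r))"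
      using Ck_on_subset[OF U(3) r(2)] by simp
    from local[OF r(1) this] r(1)
    show "\<exists>V. open V \<and> x0 \<in> V \<and> (\<forall>x\<in>V. hilbert_pv_exists f x) \<and> Ck_on k (hilbert_transform f) V"
      by (intro exI[of _ "ball x0 r"]) simp
  next
    fix U
    assume U: "open U" "x0 \<in> U" "Cinf_on f U"
    obtain r where r: "r > 0" "ball x0 (3 * r) \<subseteq> U"
      using ball[OF U(1,2)] by blast
    \<comment> \<open>The radius was fixed from \<open>U\<close> before \<open>k\<close>, so a
      single neighbourhood works for all orders, as \<open>Cinf_on\<close> demands.\<close>
    have "Ck_on (Suc k) f (ball x0 (3 * r))" for k
      using Ck_on_subset[OF _ r(2)] U(3) unfolding Cinf_on_def by blast
    from local[OF r(1) this] r(1)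
    show "\<exists>V. open V \<and> x0 \<in> V \<and> (\<forall>x\<in>V. hilbert_pv_exists f x) \<and> Cinf_on (hilbert_transform f) V"
      unfolding Cinf_on_def by (intro exI[of _ "ball x0 r"]) simp
  qed
qed

end
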